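(* Let $D\in\mathcal{D}$. Assume that for all $\alpha\in(0,1]$, all $\alpha$-Hölder functions $f\colon\mathbb{R}\to\mathbb{R}$ and all compact sets $K\subset[0,1]$ we have $$\dim_H^D f(K)\le\frac1\alpha\dim_H^D K.$$ Then $\dim_H^D=\dim_H$, that is, $\dim_H^D E=\dim_H E$ for every positive integer $n$ and every $E\subset\mathbb{R}^n$.
   Context: $|E|$ denotes the diameter of a set $E$. $\mathcal{D}$ is the family of all sets $D\subset(0,\infty)$ with $\inf D=0$ that are open in the Sorgenfrey topology (generated by the intervals $[a,b)$), i.e. for every $t\in D$ there is $\delta>0$ with $[t,t+\delta)\subset D$. For $D\in\mathcal{D}$, $E\subset\mathbb{R}^n$ and $s\ge0$ let $$\mathcal{H}^s_{D,\infty}(E)=\inf\left\{\sum_{i=1}^\infty|E_i|^s: E\subset\bigcup_{i=1}^\infty E_i,\ |E_i|\in D\text{ for all }i\right\},\qquad \dim_H^D E=\inf\{s\ge0:\mathcal{H}^s_{D,\infty}(E)=0\}.$$ $\dim_H$ is the Hausdorff dimension. A function $f\colon\mathbb{R}\to\mathbb{R}$ is $\alpha$-Hölder if there is a finite constant $C$ with $|f(x)-f(z)|\le C|x-z|^\alpha$ for all $x,z\in\mathbb{R}$. *)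

theory Defs
  imports "HOL-Analysis.Analysis"
begin

definition sorgenfrey :: "real topology" where
  "sorgenfrey = topology_generated_by {{a..<b} | a b. True}"

lemma openin_sorgenfrey_iff:
  "openin sorgenfrey D \<longleftrightarrow> (\<forall>t\<in>D. \<exists>\<delta>>0. {t..<t + \<delta>} \<subseteq> D)"
proof
  assume "openin sorgenfrey D"
  then have "generate_topology_on {{a..<b} | a b :: real. True} D"
    unfolding sorgenfrey_def by (rule openin_topology_generated_by)
  then show "\<forall>t\<in>D. \<exists>\<delta>>0. {t..<t + \<delta>} \<subseteq> D"
  proof (induction rule: generate_topology_on.induct)
    case Empty
    then show ?case by simp
  next
    case (Int A B)
    show ?case
    proof
      fix t assume "t \<in> A \<inter> B"
      then obtain d e where de: "d > 0" "e > 0" "{t..<t + d} \<subseteq> A" "{t..<t + e} \<subseteq> B"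
        using Int.IH by blast
      have "{t..<t + min d e} \<subseteq> {t..<t + d} \<inter> {t..<t + e}"
        by auto
      with de have "min d e > 0" "{t..<t + min d e} \<subseteq> A \<inter> B"
        by (simp, blast)
      then show "\<exists>\<delta>>0. {t..<t + \<delta>} \<subseteq> A \<inter> B"
        by blast
    qed
  next
    case (UN K)
    then show ?case by (meson Union_iff Union_upper subset_trans)
  next
    case (Basis S)
    then obtain a b where S: "S = {a..<b}" by blast
    show ?case
    proof
      fix t assume "t \<in> S"
      then show "\<exists>\<delta>>0. {t..<t + \<delta>} \<subseteq> S"
        using S by (intro exI[of _ "b - t"]) auto
    qed
  qed
next
  assume R: "\<forall>t\<in>D. \<exists>\<delta>>0. {t..<t + \<delta>} \<subseteq> D"
  show "openin sorgenfrey D"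
  proof (subst openin_subopen, intro ballI)
    fix t assume "t \<in> D"
    with R obtain d where d: "d > 0" "{t..<t + d} \<subseteq> D" by blast
    have "openin sorgenfrey {t..<t + d}"
      unfolding sorgenfrey_def by (rule topology_generated_by_Basis) blast
    with d show "\<exists>T. openin sorgenfrey T \<and> t \<in> T \<and> T \<subseteq> D"
      by (intro exI[of _ "{t..<t + d}"]) auto
  qed
qed

text \<open>The set is required to be nonempty because \<open>Inf {}\<close> is an unspecified real number.\<close>

definition scale_sets :: "real set set" where
  "scale_sets = {D. D \<subseteq> {0<..} \<and> D \<noteq> {} \<and> Inf D = 0 \<and> openin sorgenfrey D}"

text \<open>In both definitions of covers below, boundedness has to be stated because
  \<open>diameter\<close> is real-valued and unspecified on unbounded sets. The covering sets are
  arbitrary subsets of the ambient space.\<close>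

definition content_D :: "real set \<Rightarrow> real \<Rightarrow> 'a::euclidean_space set \<Rightarrow> ennreal" where
  "content_D D s E =
     (INF U \<in> {U :: nat \<Rightarrow> 'a set. E \<subseteq> (\<Union>i. U i) \<and> (\<forall>i. bounded (U i) \<and> diameter (U i) \<in> D)}.
        \<Sum>i. ennreal (diameter (U i) powr s))"

definition dimH_D :: "real set \<Rightarrow> 'a::euclidean_space set \<Rightarrow> ereal" where
  "dimH_D D E = (INF s \<in> {s :: real. 0 \<le> s \<and> content_D D s E = 0}. ereal s)"

text \<open>\<open>diam_pow s U\<close> is the \<open>s\<close>-th power of the diameter of \<open>U\<close>, with the usual conventions
  that the empty set contributes 0 and that \<open>0\<^sup>0 = 1\<close> for a one-point set
  (whereas \<open>0 powr 0 = 0\<close>).\<close>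

definition diam_pow :: "real \<Rightarrow> 'a::euclidean_space set \<Rightarrow> real" where
  "diam_pow s U = (if U = {} then 0 else if s = 0 then 1 else diameter U powr s)"

definition hausdorff_premeasure :: "real \<Rightarrow> real \<Rightarrow> 'a::euclidean_space set \<Rightarrow> ennreal" where
  "hausdorff_premeasure s \<delta> E =
     (INF U \<in> {U :: nat \<Rightarrow> 'a set. E \<subseteq> (\<Union>i. U i) \<and> (\<forall>i. bounded (U i) \<and> diameter (U i) \<le> \<delta>)}.
        \<Sum>i. ennreal (diam_pow s (U i)))"

definition hausdorff_measure :: "real \<Rightarrow> 'a::euclidean_space set \<Rightarrow> ennreal" where
  "hausdorff_measure s E = (SUP \<delta> \<in> {0<..}. hausdorff_premeasure s \<delta> E)"

definition hausdorff_dim :: "'a::euclidean_space set \<Rightarrow> ereal" where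
  "hausdorff_dim E = (INF s \<in> {s :: real. 0 \<le> s \<and> hausdorff_measure s E = 0}. ereal s)"

definition hoelder :: "real \<Rightarrow> (real \<Rightarrow> real) \<Rightarrow> bool" where
  "hoelder \<alpha> f \<longleftrightarrow> (\<exists>C. \<forall>x z. \<bar>f x - f z\<bar> \<le> C * \<bar>x - z\<bar> powr \<alpha>)"

end

theory Submission
  imports Defs
begin

text \<open>The inequality \<open>hausdorff_dim E \<le> dimH_D D E\<close> holds for every
\<open>D\<close>, because cheap covers by sets with diameters in \<open>D\<close> are in
particular cheap and fine covers. Equality can only fail if \<open>D\<close> has large gaps.
Indeed, suppose that for each \<open>\<epsilon> > 0\<close> every small \<open>r\<close> admits a
scale of \<open>D\<close> in \<open>{r..r powr (1 - \<epsilon>)}\<close>. Then each set of an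
arbitrary cover can be enlarged to one whose diameter is such a scale, and this costs only a
factor \<open>1 - \<epsilon>\<close> in the exponent (\<open>enlarge_to_diameter\<close>,
\<open>dimH_D_le_hausdorff_dim\<close>).

So suppose that gaps of a fixed multiplicative exponent persist. For some \<open>\<beta>\<close>
strictly between 0 and \<open>1 / 2\<close> there are then arbitrarily small
\<open>d \<in> D\<close> such that \<open>D\<close> misses
\<open>{2 * d<..d powr (1 - 2 * \<beta>)}\<close> (\<open>frequently_scale_below_gap\<close>), and
the hypothesis on Hoelder maps is violated for \<open>\<alpha> = 1 - \<beta>\<close>. Choose a
very rapidly decreasing sequence \<open>d\<^sub>k\<close> of such scales and a Cantor set
\<open>K\<close> whose construction intervals of level \<open>k\<close> have length
\<open>d\<^sub>k\<close> and whose number is about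
\<open>d\<^sub>k powr (\<beta> - 1 / 2)\<close>, up to a factor that depends on the earlier levels
only. Its natural covers use scales of \<open>D\<close>, so
\<open>dimH_D D K \<le> 1 / 2 - 3 * \<beta> / 4\<close>; the excess \<open>\<beta> / 4\<close>
over \<open>1 / 2 - \<beta>\<close> absorbs the factor. Let \<open>f\<close> map \<open>K\<close>
to the Cantor set with the same numbers of intervals, but with lengths
\<open>d\<^sub>k powr \<alpha>\<close>. This map is \<open>\<alpha>\<close>-Hoelder. The efficient
scales \<open>d\<^sub>k powr \<alpha>\<close> of the image lie inside the gaps of
\<open>D\<close>, where they are of no use for covers: the diameter \<open>r\<close> of an
admissible set is much larger or much smaller than each of them, and in both cases the set carries
at most a constant times \<open>r powr (1 / 2)\<close> of the uniform distribution. Hence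
\<open>dimH_D D (f ` K) \<ge> 1 / 2\<close> (\<open>gap_separates_dimensions\<close>), whereas the
hypothesis would give
\<open>dimH_D D (f ` K) \<le> (1 / 2 - 3 * \<beta> / 4) / (1 - \<beta>)\<close>, which is less
than \<open>1 / 2\<close>.

Both Cantor sets are parametrized by \<open>[0, 1)\<close> through the digits of a number in a
mixed-radix expansion. In this way the uniform distribution becomes Lebesgue measure, and the mass
estimate becomes a bound of \<open>\<bar>x - y\<bar>\<close> by the distance of the image
points.\<close>

section \<open>Sets of scales and contents\<close>

lemma term_le_suminf_ennreal:
  fixes f :: "nat \<Rightarrow> ennreal"
  shows "f i \<le> (\<Sum>i. f i)"
  using sum_le_suminf[of f "{i}"] by simp

lemma exists_small_scale:
  assumes "D \<in> scale_sets" "0 < \<eta>"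
  shows "\<exists>r\<in>D. 0 < r \<and> r < \<eta>"
proof -
  have D: "D \<noteq> {}" "Inf D < \<eta>" "D \<subseteq> {0<..}"
    using assms by (auto simp: scale_sets_def)
  then obtain r where "r \<in> D" "r < \<eta>"
    using cInf_lessD by blast
  with D(3) show ?thesis
    by auto
qed

lemma powr_less_of_less_root:
  fixes r s \<eta> :: real
  assumes "0 < s" "0 < \<eta>" "0 \<le> r" "r < \<eta> powr (1 / s)"
  shows "r powr s < \<eta>"
proof -
  have "r powr s < (\<eta> powr (1 / s)) powr s"
    using assms by (intro powr_less_mono2) auto
  then show ?thesis
    using assms by (simp add: powr_powr)
qed

lemma small_scale_sequence:
  assumes D: "D \<in> scale_sets" and "0 < s" "0 < \<delta>" "0 < \<eta>"
  shows "\<exists>\<rho> :: nat \<Rightarrow> real. (\<forall>i. \<rho> i \<in> D \<and> 0 < \<rho> i \<and> \<rho> i < \<delta>) \<and>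
           (\<Sum>i. ennreal (\<rho> i powr s)) \<le> ennreal \<eta>"
proof -
  define c where "c i = \<eta> * (1 / 2) ^ Suc i" for i
  have c: "0 < c i" for i
    using assms by (simp add: c_def)
  have "\<exists>r. r \<in> D \<and> 0 < r \<and> r < min \<delta> (c i powr (1 / s))" for i
    using exists_small_scale[OF D, of "min \<delta> (c i powr (1 / s))"] assms c[of i] by auto
  then obtain \<rho> where \<rho>: "\<rho> i \<in> D" "0 < \<rho> i" "\<rho> i < min \<delta> (c i powr (1 / s))" for i
    by metis
  have le: "\<rho> i powr s \<le> c i" for i
    using powr_less_of_less_root[of s "c i" "\<rho> i"] assms c[of i] \<rho>(2,3)[of i]
    by (auto intro: less_imp_le)
  have "c sums (\<eta> * 1)"
    unfolding c_def by (intro sums_mult power_half_series)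
  then have "(\<Sum>i. ennreal (c i)) = ennreal \<eta>"
    using c by (intro suminf_ennreal_eq) (auto intro: less_imp_le)
  moreover have "(\<Sum>i. ennreal (\<rho> i powr s)) \<le> (\<Sum>i. ennreal (c i))"
    by (intro suminf_le summableI ennreal_leI le)
  ultimately show ?thesis
    using \<rho> by (intro exI[of _ \<rho>]) auto
qed

text \<open>Add to \<open>U\<close> one point that moves away along a ray starting in
\<open>U\<close>. The diameter depends continuously on the position of that point, is at most
\<open>\<rho>\<close> at the start and at least \<open>\<rho>\<close> once the point has moved by
\<open>\<rho>\<close>.\<close>

lemma enlarge_to_diameter:
  fixes U :: "'a::euclidean_space set"
  assumes "bounded U" "diameter U \<le> \<rho>" "0 < \<rho>"
  shows "\<exists>V. U \<subseteq> V \<and> bounded V \<and> diameter V = \<rho>"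
proof -
  define W where "W = (if U = {} then {0} else U)"
  have W: "U \<subseteq> W" "bounded W" "diameter W \<le> \<rho>"
    using assms by (auto simp: W_def)
  have "W \<noteq> {}"
    by (simp add: W_def)
  then obtain x where x: "x \<in> W"
    by blast
  obtain e :: 'a where e: "norm e = 1"
    using vector_choose_size zero_le_one by blast
  define h where "h \<tau> = diameter (insert (x + \<tau> *\<^sub>R e) W)" for \<tau>
  have dist_h: "dist y z \<le> h \<tau>" if "y \<in> insert (x + \<tau> *\<^sub>R e) W" "z \<in> insert (x + \<tau> *\<^sub>R e) W" for y z \<tau>
    unfolding h_def using that W by (intro diameter_bounded_bound) auto
  have step: "dist (x + \<tau> *\<^sub>R e) (x + \<sigma> *\<^sub>R e) = \<bar>\<tau> - \<sigma>\<bar>" for \<tau> \<sigma>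
    using e by (simp add: dist_norm flip: scaleR_diff_left)
  have h0: "0 \<le> h \<tau>" for \<tau>
    using W(2) by (simp add: h_def diameter_ge_0)
  have lip: "h \<tau> \<le> h \<sigma> + \<bar>\<tau> - \<sigma>\<bar>" for \<tau> \<sigma>
  proof -
    let ?p = "x + \<tau> *\<^sub>R e" and ?q = "x + \<sigma> *\<^sub>R e"
    have "dist y z \<le> h \<sigma> + \<bar>\<tau> - \<sigma>\<bar>" if yz: "y \<in> insert ?p W" "z \<in> insert ?p W" for y z
    proof -
      consider "y = ?p" "z = ?p" | "y = ?p" "z \<in> W" | "y \<in> W" "z = ?p" | "y \<in> W" "z \<in> W"
        using yz by blast
      then show ?thesis
      proof cases
        case 1
        then show ?thesis using h0[of \<sigma>] by simp
      next
        case 2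
        then show ?thesis
          using dist_h[of ?q \<sigma> z] dist_triangle[of y z ?q] step[of \<tau> \<sigma>] by auto
      next
        case 3
        then show ?thesis
          using dist_h[of ?q \<sigma> y] dist_triangle[of y z ?q] step[of \<tau> \<sigma>]
          by (auto simp: dist_commute)
      next
        case 4
        then show ?thesis
          using dist_h[of y \<sigma> z] by auto
      qed
    qed
    then show ?thesis
      unfolding h_def[of \<tau>] by (intro diameter_le) (auto simp: dist_norm)
  qed
  have "\<exists>\<tau>. 0 \<le> \<tau> \<and> \<tau> \<le> \<rho> \<and> h \<tau> = \<rho>"
  proof (rule IVT')
    show "h 0 \<le> \<rho>"
      using W x by (simp add: h_def insert_absorb)
    show "\<rho> \<le> h \<rho>"
      using dist_h[of x \<rho> "x + \<rho> *\<^sub>R e"] x step[of 0 \<rho>] assms by simp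
    have "1-lipschitz_on {0..\<rho>} h"
    proof (rule lipschitz_onI)
      fix \<tau> \<sigma>
      show "dist (h \<tau>) (h \<sigma>) \<le> 1 * dist \<tau> \<sigma>"
        using lip[of \<tau> \<sigma>] lip[of \<sigma> \<tau>] by (auto simp: dist_real_def)
    qed simp
    then show "continuous_on {0..\<rho>} h"
      by (rule lipschitz_on_continuous_on)
  qed (use assms in auto)
  then obtain \<tau> where "h \<tau> = \<rho>"
    by blast
  then show ?thesis
    using W by (intro exI[of _ "insert (x + \<tau> *\<^sub>R e) W"]) (auto simp: h_def)
qed

text \<open>By enlarging the covering sets it suffices to bound their diameters by scales, rather
than to hit scales exactly.\<close>

lemma content_D_eq_0I:
  fixes E :: "'a::euclidean_space set"
  assumes D: "D \<in> scale_sets"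
    and cover: "\<And>\<eta>. 0 < \<eta> \<Longrightarrow> \<exists>U \<rho>. E \<subseteq> (\<Union>i::nat. U i) \<and>
      (\<forall>i. bounded (U i) \<and> diameter (U i) \<le> \<rho> i \<and> \<rho> i \<in> D) \<and>
      (\<Sum>i. ennreal (\<rho> i powr s)) \<le> ennreal \<eta>"
  shows "content_D D s E = 0"
proof -
  have le: "content_D D s E \<le> 0 + ennreal \<eta>" if \<eta>: "0 < \<eta>" for \<eta>
  proof -
    obtain U \<rho> where U: "E \<subseteq> (\<Union>i::nat. U i)" "\<And>i. bounded (U i)"
      "\<And>i. diameter (U i) \<le> \<rho> i" "\<And>i. \<rho> i \<in> D"
      and sum: "(\<Sum>i. ennreal (\<rho> i powr s)) \<le> ennreal \<eta>"
      using cover[OF \<eta>] by auto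
    have pos: "0 < \<rho> i" for i
      using U(4)[of i] D by (auto simp: scale_sets_def)
    have "\<forall>i. \<exists>V. U i \<subseteq> V \<and> bounded V \<and> diameter V = \<rho> i"
      using enlarge_to_diameter[OF U(2) U(3) pos] by blast
    then obtain V where V: "\<And>i. U i \<subseteq> V i" "\<And>i. bounded (V i)" "\<And>i. diameter (V i) = \<rho> i"
      by metis
    have "content_D D s E \<le> (\<Sum>i. ennreal (diameter (V i) powr s))"
      unfolding content_D_def using U V by (intro INF_lower) fastforce
    with V(3) sum show ?thesis
      by simp
  qed
  have "content_D D s E \<le> 0"
    by (rule ennreal_le_epsilon) (rule le)
  then show ?thesis
    by simp
qed

text \<open>Scales are positive, so each term of a cover contributes 1 at exponent 0, and there
are infinitely many terms.\<close>

lemma content_D_eq_0_pos: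
  fixes E :: "'a::euclidean_space set"
  assumes D: "D \<in> scale_sets" and "0 \<le> s" "content_D D s E = 0"
  shows "0 < s"
proof (rule ccontr)
  assume "\<not> 0 < s"
  then have s: "s = 0"
    using assms by simp
  have "content_D D s E < 1"
    using assms(3) by simp
  then obtain U :: "nat \<Rightarrow> 'a set" where U: "\<And>i. diameter (U i) \<in> D"
    and sum: "(\<Sum>i. ennreal (diameter (U i) powr s)) < 1"
    unfolding content_D_def INF_less_iff by blast
  have "ennreal (diameter (U 0) powr s) = 1"
    using U[of 0] D s by (auto simp: scale_sets_def)
  moreover have "ennreal (diameter (U 0) powr s) \<le> (\<Sum>i. ennreal (diameter (U i) powr s))"
    by (rule term_le_suminf_ennreal)
  ultimately show False
    using sum by simp
qed

text \<open>A cover of small total cost consists of small sets, since one large diameter alone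
would already be too expensive.\<close>

lemma content_D_eq_0E:
  fixes E :: "'a::euclidean_space set"
  assumes D: "D \<in> scale_sets" and "0 \<le> s" "content_D D s E = 0" "0 < \<delta>" "0 < \<eta>"
  obtains U :: "nat \<Rightarrow> 'a set" where "E \<subseteq> (\<Union>i. U i)" "\<And>i. bounded (U i)"
    "\<And>i. diameter (U i) \<in> D" "\<And>i. 0 < diameter (U i)" "\<And>i. diameter (U i) < \<delta>"
    "(\<Sum>i. ennreal (diameter (U i) powr s)) < ennreal \<eta>"
proof -
  have s: "0 < s"
    using content_D_eq_0_pos[OF assms(1-3)] .
  define c where "c = min \<eta> (\<delta> powr s)"
  have c: "0 < c"
    using assms by (simp add: c_def)
  have "content_D D s E < ennreal c"
    using assms(3) c by simp
  then obtain U where U: "E \<subseteq> (\<Union>i. U i)" "\<And>i. bounded (U i)" "\<And>i. diameter (U i) \<in> D"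
    and sum: "(\<Sum>i. ennreal (diameter (U i) powr s)) < ennreal c"
    unfolding content_D_def INF_less_iff by blast
  have pos: "0 < diameter (U i)" for i
    using U(3)[of i] D by (auto simp: scale_sets_def)
  have small: "diameter (U i) < \<delta>" for i
  proof -
    have "ennreal (diameter (U i) powr s) \<le> (\<Sum>i. ennreal (diameter (U i) powr s))"
      by (rule term_le_suminf_ennreal)
    then have "ennreal (diameter (U i) powr s) < ennreal c"
      using sum by (rule le_less_trans)
    then have "diameter (U i) powr s < c"
      by (subst (asm) ennreal_less_iff) auto
    then have "diameter (U i) powr s < \<delta> powr s"
      by (simp add: c_def)
    moreover have "\<delta> powr s \<le> diameter (U i) powr s" if "\<delta> \<le> diameter (U i)"
      using that s assms(4) by (intro powr_mono2) auto
    ultimately show ?thesis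
      by (meson not_less)
  qed
  have "ennreal c \<le> ennreal \<eta>"
    by (rule ennreal_leI) (simp add: c_def)
  with sum have "(\<Sum>i. ennreal (diameter (U i) powr s)) < ennreal \<eta>"
    by (rule less_le_trans)
  with that U pos small show thesis
    by blast
qed

lemma dimH_D_leI:
  assumes "0 \<le> s" "content_D D s E = 0"
  shows "dimH_D D E \<le> ereal s"
  unfolding dimH_D_def using assms by (intro INF_lower) auto

section \<open>Comparison with the Hausdorff dimension\<close>

lemma hausdorff_dim_le_dimH_D:
  fixes E :: "'a::euclidean_space set"
  assumes D: "D \<in> scale_sets"
  shows "hausdorff_dim E \<le> dimH_D D E"
  unfolding dimH_D_def
proof (rule INF_greatest)
  fix s assume "s \<in> {s :: real. 0 \<le> s \<and> content_D D s E = 0}"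
  then have s: "0 \<le> s" "content_D D s E = 0"
    by auto
  have s0: "0 < s"
    using content_D_eq_0_pos[OF D s] .
  have le: "hausdorff_premeasure s \<delta> E \<le> 0 + ennreal \<eta>" if pos: "0 < \<delta>" "0 < \<eta>" for \<delta> \<eta>
  proof -
    obtain U :: "nat \<Rightarrow> 'a set" where U: "E \<subseteq> (\<Union>i. U i)" "\<And>i. bounded (U i)"
      "\<And>i. diameter (U i) \<in> D" "\<And>i. 0 < diameter (U i)" "\<And>i. diameter (U i) < \<delta>"
      "(\<Sum>i. ennreal (diameter (U i) powr s)) < ennreal \<eta>"
      by (rule content_D_eq_0E[OF D s pos]) (rule that)
    have "hausdorff_premeasure s \<delta> E \<le> (\<Sum>i. ennreal (diam_pow s (U i)))"
      unfolding hausdorff_premeasure_def using U(1,2,5)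
      by (intro INF_lower) (auto intro: less_imp_le)
    also have "\<dots> \<le> (\<Sum>i. ennreal (diameter (U i) powr s))"
      using s0 by (intro suminf_le summableI ennreal_leI) (simp add: diam_pow_def)
    finally show ?thesis
      using U(6) by simp
  qed
  have "hausdorff_premeasure s \<delta> E \<le> 0" if "0 < \<delta>" for \<delta>
    by (rule ennreal_le_epsilon) (rule le[OF that])
  then have "hausdorff_measure s E \<le> 0"
    unfolding hausdorff_measure_def by (intro SUP_least) auto
  then have "hausdorff_measure s E = 0"
    by simp
  then show "hausdorff_dim E \<le> ereal s"
    unfolding hausdorff_dim_def using s(1) by (intro INF_lower) auto
qed

text \<open>A covering set of diameter at most \<open>r\<close> is replaced by one whose diameter
is a scale \<open>\<rho> \<le> r powr (1 - \<epsilon>)\<close>. With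
\<open>s = (1 - \<epsilon>) * s'\<close> its cost at exponent \<open>s'\<close> is at most
\<open>r powr s\<close>.\<close>

lemma dimH_D_le_hausdorff_dim:
  fixes E :: "'a::euclidean_space set"
  assumes D: "D \<in> scale_sets"
    and dense: "\<And>\<epsilon>. 0 < \<epsilon> \<Longrightarrow> \<epsilon> < 1 \<Longrightarrow>
      \<forall>\<^sub>F r in at_right 0. D \<inter> {r..r powr (1 - \<epsilon>)} \<noteq> {}"
  shows "dimH_D D E \<le> hausdorff_dim E"
  unfolding hausdorff_dim_def
proof (rule INF_greatest)
  fix s assume "s \<in> {s :: real. 0 \<le> s \<and> hausdorff_measure s E = 0}"
  then have s: "0 \<le> s" and meas: "hausdorff_measure s E = 0"
    by auto
  have cover: "\<exists>U :: nat \<Rightarrow> 'a set. E \<subseteq> (\<Union>i. U i) \<and> (\<forall>i. bounded (U i) \<and> diameter (U i) \<le> \<delta>) \<and>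
      (\<Sum>i. ennreal (diam_pow s (U i))) < ennreal \<eta>" if "0 < \<delta>" "0 < \<eta>" for \<delta> \<eta>
  proof -
    have "hausdorff_premeasure s \<delta> E \<le> hausdorff_measure s E"
      unfolding hausdorff_measure_def using that by (intro SUP_upper) auto
    then have "hausdorff_premeasure s \<delta> E < ennreal \<eta>"
      using meas that by simp
    then show ?thesis
      unfolding hausdorff_premeasure_def INF_less_iff by blast
  qed
  have "dimH_D D E \<le> ereal s'" if s': "s < s'" for s'
  proof (rule dimH_D_leI)
    show "content_D D s' E = 0"
    proof (cases "s = 0")
      case True
      obtain U :: "nat \<Rightarrow> 'a set" where U: "E \<subseteq> (\<Union>i. U i)"
        "(\<Sum>i. ennreal (diam_pow s (U i))) < ennreal 1"
        using cover[of 1 1] by auto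
      \<comment> \<open>At exponent 0 the cost counts the nonempty sets of the cover, and it is below 1.\<close>
      have "U i = {}" for i
      proof (rule ccontr)
        assume "U i \<noteq> {}"
        then have "ennreal (diam_pow s (U i)) = 1"
          using True by (simp add: diam_pow_def)
        moreover have "ennreal (diam_pow s (U i)) \<le> (\<Sum>i. ennreal (diam_pow s (U i)))"
          by (rule term_le_suminf_ennreal)
        ultimately show False
          using U(2) by simp
      qed
      then have E: "E = {}"
        using U(1) by auto
      show ?thesis
      proof (rule content_D_eq_0I[OF D])
        fix \<eta> :: real assume "0 < \<eta>"
        have "0 < s'"
          using s s' by simp
        obtain \<rho> where "\<forall>i::nat. \<rho> i \<in> D \<and> 0 < \<rho> i \<and> \<rho> i < 1"
          "(\<Sum>i. ennreal (\<rho> i powr s')) \<le> ennreal \<eta>"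
          using small_scale_sequence[OF D \<open>0 < s'\<close> zero_less_one \<open>0 < \<eta>\<close>] by blast
        then show "\<exists>U \<rho>. E \<subseteq> (\<Union>i::nat. U i) \<and>
          (\<forall>i. bounded (U i) \<and> diameter (U i) \<le> \<rho> i \<and> \<rho> i \<in> D) \<and>
          (\<Sum>i. ennreal (\<rho> i powr s')) \<le> ennreal \<eta>"
          using E by (intro exI[of _ "\<lambda>_. {}"] exI[of _ \<rho>]) (auto intro: less_imp_le)
      qed
    next
      case False
      with s have s0: "0 < s"
        by simp
      define \<epsilon> where "\<epsilon> = 1 - s / s'"
      have \<epsilon>: "0 < \<epsilon>" "\<epsilon> < 1" "(1 - \<epsilon>) * s' = s"
        using s0 s' by (auto simp: \<epsilon>_def field_simps)
      obtain \<delta> where \<delta>: "0 < \<delta>" "\<And>r. 0 < r \<Longrightarrow> r < \<delta> \<Longrightarrow> D \<inter> {r..r powr (1 - \<epsilon>)} \<noteq> {}"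
        using dense[OF \<epsilon>(1,2)] unfolding eventually_at_right_field by blast
      show ?thesis
      proof (rule content_D_eq_0I[OF D])
        fix \<eta> :: real assume \<eta>: "0 < \<eta>"
        obtain U :: "nat \<Rightarrow> 'a set" where U: "E \<subseteq> (\<Union>i. U i)"
          "\<And>i. bounded (U i)" "\<And>i. diameter (U i) \<le> \<delta> / 2"
          "(\<Sum>i. ennreal (diam_pow s (U i))) < ennreal (\<eta> / 2)"
          using cover[of "\<delta> / 2" "\<eta> / 2"] \<delta>(1) \<eta> by auto
        obtain \<sigma> where "\<forall>i::nat. \<sigma> i \<in> D \<and> 0 < \<sigma> i \<and> \<sigma> i < \<delta>"
          and \<sigma>3: "(\<Sum>i. ennreal (\<sigma> i powr s)) \<le> ennreal (\<eta> / 2)"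
          using small_scale_sequence[OF D s0 \<delta>(1) half_gt_zero[OF \<eta>]] by blast
        then have \<sigma>: "0 < \<sigma> i" "\<sigma> i < \<delta>" for i
          by auto
        \<comment> \<open>Scales comparable to \<open>r\<close> exist for \<open>r > 0\<close> only. The summable floor \<open>\<sigma>\<close> takes care of
          covering sets of diameter 0.\<close>
        define r where "r i = max (diameter (U i)) (\<sigma> i)" for i
        have r: "0 < r i" "r i < \<delta>" for i
          using \<sigma>(1,2)[of i] U(3)[of i] \<delta>(1) by (auto simp: r_def max_def)
        have "\<forall>i. \<exists>\<rho>. \<rho> \<in> D \<and> r i \<le> \<rho> \<and> \<rho> \<le> r i powr (1 - \<epsilon>)"
          using \<delta>(2)[OF r] by fastforce
        then obtain \<rho> where \<rho>: "\<And>i. \<rho> i \<in> D" "\<And>i. r i \<le> \<rho> i" "\<And>i. \<rho> i \<le> r i powr (1 - \<epsilon>)"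
          by metis
        have "\<rho> i powr s' \<le> diam_pow s (U i) + \<sigma> i powr s" for i
        proof -
          have "\<rho> i powr s' \<le> (r i powr (1 - \<epsilon>)) powr s'"
            using \<rho>(2,3)[of i] r(1)[of i] s0 s' by (intro powr_mono2) auto
          also have "\<dots> = r i powr s"
            using \<epsilon>(3) by (simp add: powr_powr)
          also have "\<dots> \<le> diam_pow s (U i) + \<sigma> i powr s"
            using s0 by (auto simp: r_def max_def diam_pow_def)
          finally show ?thesis .
        qed
        then have "(\<Sum>i. ennreal (\<rho> i powr s')) \<le> (\<Sum>i. ennreal (diam_pow s (U i)) + ennreal (\<sigma> i powr s))"
          by (intro suminf_le summableI)
             (auto simp: diam_pow_def simp flip: ennreal_plus intro!: ennreal_leI)
        also have "\<dots> = (\<Sum>i. ennreal (diam_pow s (U i))) + (\<Sum>i. ennreal (\<sigma> i powr s))"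
          by (intro suminf_add[symmetric] summableI)
        also have "\<dots> \<le> ennreal (\<eta> / 2) + ennreal (\<eta> / 2)"
          using U(4) \<sigma>3 by (intro add_mono) auto
        also have "\<dots> = ennreal \<eta>"
          using \<eta> by (simp flip: ennreal_plus)
        finally have sum: "(\<Sum>i. ennreal (\<rho> i powr s')) \<le> ennreal \<eta>" .
        have "diameter (U i) \<le> \<rho> i" for i
          using \<rho>(2)[of i] by (simp add: r_def)
        then show "\<exists>U \<rho>. E \<subseteq> (\<Union>i::nat. U i) \<and>
          (\<forall>i. bounded (U i) \<and> diameter (U i) \<le> \<rho> i \<and> \<rho> i \<in> D) \<and>
          (\<Sum>i. ennreal (\<rho> i powr s')) \<le> ennreal \<eta>"
          using U(1,2) \<rho>(1) sum by blast
      qed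
    qed
  qed (use s s' in simp)
  then show "dimH_D D E \<le> ereal s"
    using ereal_le_epsilon2[of "dimH_D D E" "ereal s"] by simp
qed

section \<open>Extension of Hoelder functions\<close>

lemma powr_add_le_add_powr:
  fixes a b \<alpha> :: real
  assumes "0 \<le> a" "0 \<le> b" "0 < \<alpha>" "\<alpha> \<le> 1"
  shows "(a + b) powr \<alpha> \<le> a powr \<alpha> + b powr \<alpha>"
proof (cases "a + b = 0")
  case True
  then show ?thesis
    using assms by auto
next
  case False
  define c where "c = a + b"
  have c: "0 < c"
    using False assms by (simp add: c_def)
  have le: "x / c * c powr \<alpha> \<le> x powr \<alpha>" if "0 \<le> x" "x \<le> c" for x
  proof -
    have "(x / c) powr 1 \<le> (x / c) powr \<alpha>"
      using that c assms by (intro powr_mono') auto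
    then have "x / c * c powr \<alpha> \<le> (x / c) powr \<alpha> * c powr \<alpha>"
      using that c by (intro mult_right_mono) auto
    also have "\<dots> = x powr \<alpha>"
      using that c by (subst powr_mult[symmetric]) auto
    finally show ?thesis .
  qed
  have "c powr \<alpha> = a / c * c powr \<alpha> + b / c * c powr \<alpha>"
    using c by (simp add: c_def flip: distrib_right add_divide_distrib)
  also have "\<dots> \<le> a powr \<alpha> + b powr \<alpha>"
    using assms by (intro add_mono le) (auto simp: c_def)
  finally show ?thesis
    by (simp add: c_def)
qed

text \<open>McShane's extension: the infimum of the cones
\<open>\<gamma> i + C * \<bar>x - \<kappa> i\<bar> powr \<alpha>\<close>. It works because
\<open>\<bar>x - z\<bar> powr \<alpha>\<close> is a metric for \<open>\<alpha> \<le> 1\<close>.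
The prescribed values are indexed by \<open>I\<close>, so that the partial function
\<open>\<kappa> i \<mapsto> \<gamma> i\<close> need not be named.\<close>

lemma hoelder_extension:
  fixes \<kappa> \<gamma> :: "'i \<Rightarrow> real"
  assumes \<alpha>: "0 < \<alpha>" "\<alpha> \<le> 1" and C: "0 \<le> C"
    and le: "\<And>i j. i \<in> I \<Longrightarrow> j \<in> I \<Longrightarrow> \<bar>\<gamma> i - \<gamma> j\<bar> \<le> C * \<bar>\<kappa> i - \<kappa> j\<bar> powr \<alpha>"
  shows "\<exists>f. hoelder \<alpha> f \<and> (\<forall>i\<in>I. f (\<kappa> i) = \<gamma> i)"
proof (cases "I = {}")
  case True
  then show ?thesis
    by (intro exI[of _ "\<lambda>_. 0"]) (auto simp: hoelder_def intro!: exI[of _ 0])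
next
  case False
  define f where "f x = (INF i\<in>I. \<gamma> i + C * \<bar>x - \<kappa> i\<bar> powr \<alpha>)" for x
  have tri: "C * \<bar>x - z\<bar> powr \<alpha> \<le> C * \<bar>x - y\<bar> powr \<alpha> + C * \<bar>y - z\<bar> powr \<alpha>" for x y z
  proof -
    have "\<bar>x - z\<bar> powr \<alpha> \<le> (\<bar>x - y\<bar> + \<bar>y - z\<bar>) powr \<alpha>"
      using \<alpha> by (intro powr_mono2) auto
    also have "\<dots> \<le> \<bar>x - y\<bar> powr \<alpha> + \<bar>y - z\<bar> powr \<alpha>"
      using \<alpha> by (intro powr_add_le_add_powr) auto
    finally show ?thesis
      using C by (simp add: mult_left_mono flip: distrib_left)
  qed
  have low: "\<gamma> j - C * \<bar>x - \<kappa> j\<bar> powr \<alpha> \<le> \<gamma> i + C * \<bar>x - \<kappa> i\<bar> powr \<alpha>" if "i \<in> I" "j \<in> I" for i j x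
    using le[OF that] tri[of "\<kappa> i" "\<kappa> j" x] by (simp add: abs_minus_commute)
  have bdd: "bdd_below ((\<lambda>i. \<gamma> i + C * \<bar>x - \<kappa> i\<bar> powr \<alpha>) ` I)" for x
    using False low by (meson all_not_in_conv bdd_belowI2)
  have upper: "f x \<le> f z + C * \<bar>x - z\<bar> powr \<alpha>" for x z
  proof -
    have "f x - C * \<bar>x - z\<bar> powr \<alpha> \<le> f z"
      unfolding f_def[of z]
    proof (rule cINF_greatest[OF False])
      fix i assume "i \<in> I"
      then have "f x \<le> \<gamma> i + C * \<bar>x - \<kappa> i\<bar> powr \<alpha>"
        unfolding f_def by (intro cINF_lower bdd)
      then show "f x - C * \<bar>x - z\<bar> powr \<alpha> \<le> \<gamma> i + C * \<bar>z - \<kappa> i\<bar> powr \<alpha>"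
        using tri[of x "\<kappa> i" z] by simp
    qed
    then show ?thesis
      by simp
  qed
  have "\<bar>f x - f z\<bar> \<le> C * \<bar>x - z\<bar> powr \<alpha>" for x z
    using upper[of x z] upper[of z x] by (simp add: abs_le_iff abs_minus_commute[of z x])
  then have "hoelder \<alpha> f"
    unfolding hoelder_def by blast
  moreover have "f (\<kappa> j) = \<gamma> j" if j: "j \<in> I" for j
  proof (rule antisym)
    show "f (\<kappa> j) \<le> \<gamma> j"
      unfolding f_def using cINF_lower[OF bdd j, of "\<kappa> j"] \<alpha> by simp
    show "\<gamma> j \<le> f (\<kappa> j)"
      unfolding f_def by (rule cINF_greatest[OF False]) (use low[OF _ j, of _ "\<kappa> j"] in simp)
  qed
  ultimately show ?thesis
    by blast
qed

section \<open>A lower bound for the dimension of a parametrized set\<close>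

text \<open>The mass distribution principle for the image of Lebesgue measure under
\<open>g\<close>: the preimage of a covering set of diameter \<open>r\<close> lies in an interval
of length at most \<open>2 * C * r powr t\<close>, and these intervals have to cover
\<open>[0, 1)\<close>. The expansion estimate is required at the scales of \<open>D\<close> only,
which is how gaps in \<open>D\<close> can raise the dimension.\<close>

lemma dimH_D_image_ge:
  fixes g :: "real \<Rightarrow> 'a::euclidean_space"
  assumes D: "D \<in> scale_sets"
    and expand: "\<And>x y r. x \<in> {0..<1} \<Longrightarrow> y \<in> {0..<1} \<Longrightarrow> r \<in> D \<Longrightarrow> r < 1 \<Longrightarrow>
      dist (g x) (g y) \<le> r \<Longrightarrow> \<bar>x - y\<bar> \<le> C * r powr t"
    and C: "0 < C" and sub: "g ` {0..<1} \<subseteq> A"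
  shows "ereal t \<le> dimH_D D A"
  unfolding dimH_D_def
proof (rule INF_greatest)
  fix s assume "s \<in> {s. 0 \<le> s \<and> content_D D s A = 0}"
  then have s: "0 \<le> s" "content_D D s A = 0"
    by auto
  have "t \<le> s"
  proof (rule ccontr)
    assume "\<not> t \<le> s"
    then have st: "s < t"
      by simp
    have C': "0 < 1 / (2 * C)"
      using C by simp
    obtain U :: "nat \<Rightarrow> 'a set" where U: "A \<subseteq> (\<Union>i. U i)" "\<And>i. bounded (U i)"
      "\<And>i. diameter (U i) \<in> D" "\<And>i. 0 < diameter (U i)" "\<And>i. diameter (U i) < 1"
      and sum: "(\<Sum>i. ennreal (diameter (U i) powr s)) < ennreal (1 / (2 * C))"
      by (rule content_D_eq_0E[OF D s zero_less_one C']) (rule that)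
    define r where "r i = C * diameter (U i) powr s" for i
    have r: "0 \<le> r i" for i
      using C by (simp add: r_def)
    have "\<exists>c. {x\<in>{0..<1}. g x \<in> U i} \<subseteq> {c - r i..c + r i}" for i
    proof (cases "{x\<in>{0..<1}. g x \<in> U i} = {}")
      case False
      then obtain c where c: "c \<in> {0..<1}" "g c \<in> U i"
        by blast
      have "\<bar>x - c\<bar> \<le> r i" if x: "x \<in> {0..<1}" "g x \<in> U i" for x
      proof -
        have "\<bar>x - c\<bar> \<le> C * diameter (U i) powr t"
          by (rule expand[OF x(1) c(1) U(3) U(5)]) (rule diameter_bounded_bound[OF U(2) x(2) c(2)])
        also have "\<dots> \<le> r i"
          unfolding r_def using C st U(4,5)[of i] by (intro mult_left_mono powr_mono') auto
        finally show ?thesis .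
      qed
      then have "{x\<in>{0..<1}. g x \<in> U i} \<subseteq> {c - r i..c + r i}"
        by (force simp: abs_le_iff)
      then show ?thesis ..
    qed blast
    then obtain c where c: "\<And>i. {x\<in>{0..<1}. g x \<in> U i} \<subseteq> {c i - r i..c i + r i}"
      by metis
    have "{0..<1} \<subseteq> (\<Union>i. {c i - r i..c i + r i})"
    proof
      fix x :: real assume x: "x \<in> {0..<1}"
      then obtain i where "g x \<in> U i"
        using sub U(1) by blast
      with x c[of i] show "x \<in> (\<Union>i. {c i - r i..c i + r i})"
        by blast
    qed
    then have "emeasure lborel {0..<1::real} \<le> emeasure lborel (\<Union>i. {c i - r i..c i + r i})"
      by (intro emeasure_mono) auto
    also have "\<dots> \<le> (\<Sum>i. emeasure lborel {c i - r i..c i + r i})"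
      by (intro emeasure_subadditive_countably) auto
    also have "\<dots> = (\<Sum>i. ennreal (2 * C) * ennreal (diameter (U i) powr s))"
    proof (intro suminf_cong)
      fix i
      have "emeasure lborel {c i - r i..c i + r i} = ennreal (2 * r i)"
        using r[of i] by (subst emeasure_lborel_Icc) auto
      also have "2 * r i = 2 * C * diameter (U i) powr s"
        by (simp add: r_def)
      finally show "emeasure lborel {c i - r i..c i + r i} = ennreal (2 * C) * ennreal (diameter (U i) powr s)"
        using C by (simp add: ennreal_mult)
    qed
    also have "\<dots> = ennreal (2 * C) * (\<Sum>i. ennreal (diameter (U i) powr s))"
      by (rule ennreal_suminf_cmult)
    also have "\<dots> < ennreal (2 * C) * ennreal (1 / (2 * C))"
      using sum C by (intro ennreal_mult_strict_left_mono) auto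
    also have "\<dots> = 1"
      using C by (simp flip: ennreal_mult)
    finally show False
      by simp
  qed
  then show "ereal t \<le> ereal s"
    by simp
qed

section \<open>Mixed-radix cells of the unit interval\<close>

text \<open>\<open>N k\<close> is the number of parts into which each interval of level
\<open>k\<close> is divided. The half-open interval \<open>[0, 1)\<close> is thus divided into
\<open>num_cells k\<close> equal cells of level \<open>k\<close>, numbered from left to right by
\<open>cell k\<close>.\<close>

locale branching =
  fixes N :: "nat \<Rightarrow> nat"
  assumes two_le_N: "2 \<le> N k"
begin

definition num_cells :: "nat \<Rightarrow> nat" where
  "num_cells k = (\<Prod>i<k. N i)"

definition cell :: "nat \<Rightarrow> real \<Rightarrow> int" where
  "cell k x = \<lfloor>x * num_cells k\<rfloor>"

definition digit :: "nat \<Rightarrow> real \<Rightarrow> int" where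
  "digit k x = cell (Suc k) x mod int (N k)"

lemma N_pos: "0 < N k"
  using two_le_N[of k] by simp

lemma num_cells_0 [simp]: "num_cells 0 = 1"
  and num_cells_Suc: "num_cells (Suc k) = num_cells k * N k"
  by (simp_all add: num_cells_def)

lemma num_cells_pos: "0 < num_cells k"
  using N_pos by (simp add: num_cells_def prod_pos)

lemma two_power_le_num_cells: "2 ^ k \<le> num_cells k"
proof (induction k)
  case (Suc k)
  show ?case
    using mult_mono[OF Suc two_le_N[of k]] by (simp add: num_cells_Suc mult.commute)
qed simp

lemma mono_num_cells: "i \<le> j \<Longrightarrow> num_cells i \<le> num_cells j"
proof (induction j rule: dec_induct)
  case (step j)
  have "num_cells j * 1 \<le> num_cells j * N j"
    using N_pos[of j] by (intro mult_left_mono) auto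
  with step.IH have "num_cells i \<le> num_cells j * N j"
    by linarith
  then show ?case
    by (simp add: num_cells_Suc)
qed simp

lemma cell_eq_div: "cell k x = cell (Suc k) x div int (N k)"
proof -
  have "x * num_cells k = (x * num_cells (Suc k)) / real_of_int (int (N k))"
    using N_pos[of k] by (simp add: num_cells_Suc)
  then show ?thesis
    unfolding cell_def by (simp only: floor_divide_real_eq_div of_nat_0_le_iff)
qed

lemma cell_Suc: "cell (Suc k) x = int (N k) * cell k x + digit k x"
  unfolding digit_def by (subst cell_eq_div) simp

lemma digit_nonneg: "0 \<le> digit k x"
  and digit_less: "digit k x < int (N k)"
  using N_pos[of k] by (simp_all add: digit_def)

lemma cell_mono: "x \<le> y \<Longrightarrow> cell k x \<le> cell k y"
  unfolding cell_def by (intro floor_mono mult_right_mono) auto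

lemma cell_eq_le: "cell n x = cell n y \<Longrightarrow> k \<le> n \<Longrightarrow> cell k x = cell k y"
proof (induction n)
  case (Suc n)
  then show ?case
    using cell_eq_div[of n x] cell_eq_div[of n y] by (cases "k = Suc n") auto
qed simp

lemma digit_eq: "cell n x = cell n y \<Longrightarrow> k < n \<Longrightarrow> digit k x = digit k y"
  unfolding digit_def using cell_eq_le[of n x y "Suc k"] by simp

lemma diff_times_num_cells_le:
  fixes x y :: real
  shows "(y - x) * num_cells k \<le> real_of_int (cell k y - cell k x) + 1"
  unfolding cell_def left_diff_distrib by linarith

lemma diff_le_of_cell_eq:
  fixes x y :: real
  assumes "cell k x = cell k y"
  shows "y - x \<le> 1 / num_cells k"
  using diff_times_num_cells_le[of y x k] assms num_cells_pos[of k] by (simp add: field_simps)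

lemma cell_in_range:
  assumes "x \<in> {0..<1}"
  shows "cell k x \<in> {0..<int (num_cells k)}"
  using assms num_cells_pos[of k] by (auto simp: cell_def floor_less_iff)

text \<open>Distinct points share their cells up to some level \<open>n\<close> and then separate
for good; this level governs their distance in every Cantor set built over the cells.\<close>

lemma separation_level:
  assumes "x \<in> {0..<1}" "y \<in> {0..<1}" "x < y"
  obtains n m where "cell n x = cell n y" "cell (Suc n) y = cell (Suc n) x + m"
    "1 \<le> m" "m \<le> int (N n)"
proof -
  have ex: "\<exists>k. cell k x \<noteq> cell k y"
  proof (rule ccontr)
    assume "\<nexists>k. cell k x \<noteq> cell k y"
    then have le: "y - x \<le> 1 / num_cells k" for k
      using diff_le_of_cell_eq by blast
    obtain k where k: "1 / (y - x) < 2 ^ k"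
      using real_arch_pow[of 2 "1 / (y - x)"] by auto
    also have "(2::real) ^ k \<le> num_cells k"
      using two_power_le_num_cells[of k] by (metis of_nat_le_iff of_nat_numeral of_nat_power)
    finally have "1 / num_cells k < y - x"
      using assms(3) num_cells_pos[of k] by (simp add: field_simps)
    with le[of k] show False
      by simp
  qed
  define k where "k = (LEAST k. cell k x \<noteq> cell k y)"
  have k: "cell k x \<noteq> cell k y"
    unfolding k_def using ex by (rule LeastI_ex)
  have "cell 0 x = cell 0 y"
    using cell_in_range[OF assms(1), of 0] cell_in_range[OF assms(2), of 0] by simp
  with k obtain n where n: "k = Suc n"
    by (cases k) auto
  have eq: "cell n x = cell n y"
    using not_less_Least[of n "\<lambda>k. cell k x \<noteq> cell k y"] n by (simp add: k_def)
  define m where "m = cell (Suc n) y - cell (Suc n) x"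
  have "1 \<le> m"
    using cell_mono[of x y "Suc n"] k n assms(3) by (simp add: m_def)
  moreover have "m \<le> int (N n)"
    using eq cell_Suc[of n x] cell_Suc[of n y] digit_nonneg[of n x] digit_less[of n y]
    by (simp add: m_def)
  ultimately show thesis
    using that[OF eq, of m] by (simp add: m_def)
qed

end

section \<open>Cantor sets over the cells\<close>

text \<open>The cells of level \<open>k\<close> are placed into intervals of length
\<open>l k\<close>. Such an interval has room for \<open>N k\<close> equally spaced slots of
length \<open>l k / N k\<close>, and each child interval sits at the left end of its slot. By
\<open>l_Suc\<close> the child fills at most half of its slot, so neighbours stay at a distance
comparable to the slot length.\<close>

locale cantor_embedding = branching N for N +
  fixes l :: "nat \<Rightarrow> real"
  assumes l_pos: "0 < l k"
    and l_Suc: "2 * N k * l (Suc k) \<le> l k"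
begin

definition offset :: "nat \<Rightarrow> real \<Rightarrow> real" where
  "offset k x = digit k x * (l k / N k)"

text \<open>The parametrization of the Cantor set (up to countably many points) by
\<open>[0, 1)\<close>: the \<open>k\<close>-th digit selects the slot at level
\<open>k\<close>.\<close>

definition embed :: "real \<Rightarrow> real" where
  "embed x = (\<Sum>k. offset k x)"

lemma offset_nonneg: "0 \<le> offset k x"
  using digit_nonneg[of k x] l_pos[of k] by (simp add: offset_def)

lemma l_Suc_le: "l (Suc k) \<le> l k / N k / 2"
  using l_Suc[of k] N_pos[of k] by (simp add: field_simps)

lemma offset_le: "offset k x \<le> l k - l (Suc k)"
proof -
  have "offset k x \<le> (real (N k) - 1) * (l k / N k)"
    unfolding offset_def using digit_less[of k x] l_pos[of k]
    by (intro mult_right_mono) (auto simp: of_int_le_iff[symmetric, of _ "_ - 1"] simp del: of_int_le_iff)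
  also have "\<dots> = l k - l k / N k"
    using N_pos[of k] by (simp add: field_simps)
  also have "\<dots> \<le> l k - l (Suc k)"
    using l_Suc_le[of k] l_pos[of "Suc k"] by simp
  finally show ?thesis .
qed

text \<open>The offsets telescope, by \<open>offset_le\<close>: the points of a cell of level
\<open>m\<close> remain inside its interval of length \<open>l m\<close>.\<close>

lemma sum_offset_le: "(\<Sum>k<n. offset (k + m) x) \<le> l m"
proof -
  have "(\<Sum>k<n. offset (k + m) x) \<le> l m - l (n + m)"
  proof (induction n)
    case (Suc n)
    then show ?case
      using offset_le[of "n + m" x] by simp
  qed simp
  then show ?thesis
    using l_pos[of "n + m"] by simp
qed

lemma summable_offset: "summable (\<lambda>k. offset (k + m) x)"
  by (rule summableI_nonneg_bounded[OF offset_nonneg sum_offset_le])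

lemma tail_nonneg: "0 \<le> (\<Sum>k. offset (k + m) x)"
  by (rule suminf_nonneg[OF summable_offset offset_nonneg])

lemma tail_le: "(\<Sum>k. offset (k + m) x) \<le> l m"
  by (rule suminf_le_const[OF summable_offset sum_offset_le])

lemma embed_split: "embed x = (\<Sum>k<n. offset k x) + (\<Sum>k. offset (k + n) x)"
  unfolding embed_def
  using suminf_split_initial_segment[of "\<lambda>k. offset k x" n] summable_offset[of 0 x] by simp

lemma embed_in_range: "embed x \<in> {0..l 0}"
  using tail_nonneg[of 0 x] tail_le[of 0 x] by (simp add: embed_def)

lemma head_eq:
  assumes "cell n x = cell n y"
  shows "(\<Sum>k<n. offset k x) = (\<Sum>k<n. offset k y)"
  using digit_eq[OF assms] by (intro sum.cong) (auto simp: offset_def)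

lemma embed_diff_le_of_cell_eq:
  assumes "cell n x = cell n y"
  shows "\<bar>embed x - embed y\<bar> \<le> l n"
  using embed_split[of x n] embed_split[of y n] head_eq[OF assms]
    tail_nonneg[of n x] tail_nonneg[of n y] tail_le[of n x] tail_le[of n y]
  by simp

text \<open>At the separating level the points lie \<open>m\<close> slots apart. The deeper digits
move each of them by at most half a slot.\<close>

lemma embed_diff_at_separation:
  assumes eq: "cell n x = cell n y" and m: "cell (Suc n) y = cell (Suc n) x + m" "1 \<le> m"
  shows "m * (l n / N n) / 2 \<le> embed y - embed x"
    and "embed y - embed x \<le> 2 * (m * (l n / N n))"
proof -
  have "digit n y - digit n x = m"
    using cell_Suc[of n x] cell_Suc[of n y] eq m by simp
  then have off: "offset n y - offset n x = m * (l n / N n)"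
    unfolding offset_def left_diff_distrib[symmetric] by (metis of_int_diff)
  define z where "z = m * (l n / N n)"
  have diff: "embed y - embed x
      = z + ((\<Sum>k. offset (k + Suc n) y) - (\<Sum>k. offset (k + Suc n) x))"
    using embed_split[of x "Suc n"] embed_split[of y "Suc n"] head_eq[OF eq] off
    by (simp add: z_def)
  have "1 * (l n / N n) \<le> z"
    unfolding z_def using m(2) l_pos[of n] by (intro mult_right_mono) auto
  with l_Suc_le[of n] have "l (Suc n) \<le> z / 2"
    by simp
  with diff tail_nonneg[of "Suc n" x] tail_nonneg[of "Suc n" y] tail_le[of "Suc n" x] tail_le[of "Suc n" y]
  have "z / 2 \<le> embed y - embed x" "embed y - embed x \<le> 2 * z"
    using l_pos[of "Suc n"] by linarith+
  then show "m * (l n / N n) / 2 \<le> embed y - embed x" "embed y - embed x \<le> 2 * (m * (l n / N n))"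
    by (simp_all only: z_def)
qed

text \<open>\<open>l k * num_cells k\<close> is the total length of the intervals of level
\<open>k\<close>, and children fill at most half of their slots.\<close>

lemma l_times_num_cells_antimono:
  assumes "n \<le> k"
  shows "l k * num_cells k \<le> l n * num_cells n"
  using assms
proof (induction k rule: dec_induct)
  case (step k)
  have "l (Suc k) * N k \<le> l k"
    using l_Suc_le[of k] l_pos[of k] N_pos[of k] by (simp add: field_simps)
  then have "(l (Suc k) * N k) * num_cells k \<le> l k * num_cells k"
    by (intro mult_right_mono) auto
  with step.IH show ?case
    by (simp add: num_cells_Suc mult_ac)
qed simp

text \<open>Up to a constant, \<open>embed\<close> contracts distances of points that separate at
level \<open>n\<close> by at most the factor \<open>l n * num_cells n\<close>: they are at most
\<open>2 * m / num_cells (Suc n)\<close> apart before, and at least \<open>m / 2\<close> slots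
apart after. By monotonicity of the total length the factor for a deeper level \<open>k\<close>
may be used instead.\<close>

lemma diff_le_embed_diff:
  assumes eq: "cell n x = cell n y" and m: "cell (Suc n) y = cell (Suc n) x + m" "1 \<le> m"
    and "n \<le> k"
  shows "(y - x) * (l k * num_cells k) \<le> 4 * (embed y - embed x)"
proof -
  have sep: "m * (l n / N n) / 2 \<le> embed y - embed x"
    using embed_diff_at_separation[OF eq m] by simp
  have "(y - x) * num_cells (Suc n) \<le> real_of_int m + 1"
    using diff_times_num_cells_le[of y x "Suc n"] m by simp
  also have "\<dots> \<le> 2 * m"
    using m by simp
  finally have "((y - x) * num_cells (Suc n)) * (l n / N n) \<le> 2 * m * (l n / N n)"
    using l_pos[of n] by (intro mult_right_mono) auto
  also have "\<dots> = 4 * (m * (l n / N n) / 2)"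
    by simp
  also have "\<dots> \<le> 4 * (embed y - embed x)"
    using sep by (intro mult_left_mono) auto
  also have "((y - x) * num_cells (Suc n)) * (l n / N n) = (y - x) * (l n * num_cells n)"
    using N_pos[of n] by (simp add: num_cells_Suc)
  finally have le: "(y - x) * (l n * num_cells n) \<le> 4 * (embed y - embed x)" .
  show ?thesis
  proof (cases "x \<le> y")
    case True
    then have "(y - x) * (l k * num_cells k) \<le> (y - x) * (l n * num_cells n)"
      using l_times_num_cells_antimono[OF \<open>n \<le> k\<close>] by (intro mult_left_mono) auto
    with le show ?thesis
      by simp
  next
    case False
    have "0 \<le> m * (l n / N n) / 2"
      using m l_pos[of n] by simp
    then have "0 \<le> embed y - embed x"
      using sep by simp
    moreover have "(y - x) * (l k * num_cells k) \<le> 0"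
      using False l_pos[of k] by (intro mult_nonpos_nonneg) auto
    ultimately show ?thesis
      by simp
  qed
qed

end

context branching
begin

text \<open>Points separated by \<open>m\<close> of the \<open>N n\<close> slots at level
\<open>n\<close> are at distance about \<open>q * d n\<close> in one Cantor set and
\<open>q * d n powr \<alpha>\<close> in the other, where \<open>q = m / N n \<le> 1\<close>; and
\<open>q \<le> q powr \<alpha>\<close>.\<close>

lemma embed_hoelder:
  fixes d :: "nat \<Rightarrow> real"
  assumes \<alpha>: "0 < \<alpha>" "\<alpha> \<le> 1"
    and d: "cantor_embedding N d" and e: "cantor_embedding N (\<lambda>k. d k powr \<alpha>)"
    and xy: "x \<in> {0..<1}" "y \<in> {0..<1}"
  shows "\<bar>cantor_embedding.embed N (\<lambda>k. d k powr \<alpha>) x - cantor_embedding.embed N (\<lambda>k. d k powr \<alpha>) y\<bar>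
    \<le> 4 * \<bar>cantor_embedding.embed N d x - cantor_embedding.embed N d y\<bar> powr \<alpha>"
proof -
  interpret d: cantor_embedding N d by (rule d)
  interpret e: cantor_embedding N "\<lambda>k. d k powr \<alpha>" by (rule e)
  have main: "\<bar>e.embed y - e.embed x\<bar> \<le> 4 * \<bar>d.embed y - d.embed x\<bar> powr \<alpha>"
    if xy: "x \<in> {0..<1}" "y \<in> {0..<1}" "x < y" for x y
  proof -
    obtain n m where eq: "cell n x = cell n y" and m: "cell (Suc n) y = cell (Suc n) x + m"
      "1 \<le> m" "m \<le> int (N n)"
      using separation_level[OF xy] .
    define q where "q = m / N n"
    have q: "0 < q" "q \<le> 1"
      using m N_pos[of n] by (auto simp: q_def)
    have d0: "0 < d n"
      by (rule d.l_pos)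
    have dle: "q * d n / 2 \<le> d.embed y - d.embed x"
      using d.embed_diff_at_separation(1)[OF eq m(1,2)] by (simp add: q_def)
    have "0 \<le> m * (d n powr \<alpha> / N n) / 2"
      using m by simp
    then have ebound: "0 \<le> e.embed y - e.embed x" "e.embed y - e.embed x \<le> 2 * (q * d n powr \<alpha>)"
      using e.embed_diff_at_separation[OF eq m(1,2)] by (auto simp: q_def)
    have "q powr 1 \<le> q powr \<alpha>"
      using q \<alpha> by (intro powr_mono') auto
    then have "q * d n powr \<alpha> \<le> q powr \<alpha> * d n powr \<alpha>"
      using q by (intro mult_right_mono) auto
    also have "\<dots> = (2 * (q * d n / 2)) powr \<alpha>"
      using q d0 by (simp add: powr_mult)
    also have "\<dots> \<le> (2 * \<bar>d.embed y - d.embed x\<bar>) powr \<alpha>"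
      using dle \<alpha> q d0 abs_ge_self[of "d.embed y - d.embed x"] by (intro powr_mono2) auto
    also have "\<dots> = 2 powr \<alpha> * \<bar>d.embed y - d.embed x\<bar> powr \<alpha>"
      by (simp add: powr_mult)
    also have "\<dots> \<le> 2 * \<bar>d.embed y - d.embed x\<bar> powr \<alpha>"
      using \<alpha> powr_mono[of \<alpha> 1 "2::real"] by (intro mult_right_mono) auto
    finally show ?thesis
      using ebound by simp
  qed
  show ?thesis
    using main[OF xy] main[OF xy(2,1)]
    by (cases x y rule: linorder_cases) (auto simp: abs_minus_commute)
qed

end

section \<open>Gaps in the set of scales\<close>

text \<open>The gap \<open>{r..r powr (1 - \<epsilon>)}\<close> is attached to a scale: take
\<open>d \<in> D\<close> below \<open>r\<close> that exceeds half the supremum of all scales below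
\<open>r\<close>. The scales above \<open>2 * d\<close> are then at least \<open>r\<close>, and,
as \<open>D\<close> misses the gap, beyond \<open>r powr (1 - \<epsilon>)\<close> and so beyond
\<open>d powr (1 - \<epsilon>)\<close>. The factor 2 is there because the supremum need not be
attained.\<close>

lemma frequently_scale_below_gap:
  assumes D: "D \<in> scale_sets" and \<epsilon>: "0 < \<epsilon>" "\<epsilon> < 1"
    and gap: "\<exists>\<^sub>F r in at_right 0. D \<inter> {r..r powr (1 - \<epsilon>)} = {}"
  shows "\<exists>\<^sub>F d in at_right 0. d \<in> D \<and> D \<inter> {2 * d<..d powr (1 - \<epsilon>)} = {}"
  unfolding frequently_def eventually_at_right_field
proof (rule notI, elim exE conjE)
  fix b :: real
  assume b: "0 < b" and none: "\<forall>y>0. y < b \<longrightarrow> \<not> (y \<in> D \<and> D \<inter> {2 * y<..y powr (1 - \<epsilon>)} = {})"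
  obtain r where r: "0 < r" "r < b" "D \<inter> {r..r powr (1 - \<epsilon>)} = {}"
    using gap b unfolding frequently_def eventually_at_right_field by blast
  define S where "S = D \<inter> {0<..<r}"
  obtain d0 where d0: "d0 \<in> S"
    using exists_small_scale[OF D r(1)] by (auto simp: S_def)
  have bdd: "bdd_above S"
    by (auto simp: S_def intro: bdd_aboveI[of _ r])
  have "0 < Sup S"
    using cSup_upper[OF d0 bdd] d0 by (auto simp: S_def)
  then have "Sup S / 2 < Sup S"
    by simp
  then obtain d where d: "d \<in> S" "Sup S / 2 < d"
    using less_cSup_iff[OF _ bdd, of "Sup S / 2"] d0 by blast
  have "D \<inter> {2 * d<..d powr (1 - \<epsilon>)} = {}"
  proof (rule ccontr)
    assume "D \<inter> {2 * d<..d powr (1 - \<epsilon>)} \<noteq> {}"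
    then obtain r' where r': "r' \<in> D" "2 * d < r'" "r' \<le> d powr (1 - \<epsilon>)"
      by auto
    have "r' \<notin> S"
      using cSup_upper[OF _ bdd, of r'] r' d(2) by auto
    then have "r \<le> r'"
      using r' d(1) by (auto simp: S_def)
    moreover have "d powr (1 - \<epsilon>) \<le> r powr (1 - \<epsilon>)"
      using d(1) \<epsilon> by (intro powr_mono2) (auto simp: S_def)
    ultimately show False
      using r' r(3) by auto
  qed
  with none d(1) r(2) show False
    by (auto simp: S_def)
qed

lemma eventually_mult_powr_less:
  fixes a b c :: real
  assumes "0 < a" "0 < b"
  shows "\<forall>\<^sub>F x in at_right 0. c * x powr a < b"
proof -
  have "((\<lambda>x::real. x) \<longlongrightarrow> 0) (at_right 0)"
    by (rule tendsto_ident_at)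
  moreover have "\<forall>\<^sub>F x::real in at_right 0. 0 \<le> x"
    using eventually_at_right_less[of "0::real"] by (rule eventually_mono) simp
  ultimately have "((\<lambda>x::real. x powr a) \<longlongrightarrow> 0) (at_right 0)"
    using assms by (intro tendsto_zero_powrI[OF _ tendsto_const]) auto
  then have "((\<lambda>x. c * x powr a) \<longlongrightarrow> 0) (at_right 0)"
    by (rule tendsto_mult_right_zero)
  then show ?thesis
    using assms(2) by (rule order_tendstoD)
qed

lemma ceiling_powr_bounds:
  fixes d u :: real
  assumes "0 < d" "d < 1" "0 < u"
  defines "n \<equiv> nat \<lceil>d powr (-u)\<rceil>"
  shows "2 \<le> n" "d powr (-u) \<le> real n" "real n \<le> 2 * d powr (-u)"
proof -
  have "1 < d powr (-u)"
    using assms powr_less_mono2_neg[of "-u" d 1] by simp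
  then show "2 \<le> n" "d powr (-u) \<le> real n" "real n \<le> 2 * d powr (-u)"
    unfolding n_def by linarith+
qed

text \<open>One step of the choice of scales: \<open>d\<close> is the current scale,
\<open>p\<close> the current number of cells, \<open>d'\<close> the next scale and
\<open>n\<close> the number of children, for which \<open>d' powr (\<beta> - 1 / 2)\<close>
rounded up is suitable. The conditions say that the children fill at most half of their slots in
both Cantor sets, and that at exponent \<open>1 / 2 - 3 * \<beta> / 4\<close> the intervals of the
next level have total cost at most \<open>d\<close>. After insertion of \<open>n\<close> each of
them bounds a positive power of \<open>d'\<close>, with exponents \<open>1 / 2 + \<beta>\<close>,
\<open>1 / 2\<close> and \<open>\<beta> / 4\<close>; so all of them hold for small
\<open>d'\<close>.\<close>

lemma next_scale:
  assumes \<beta>: "0 < \<beta>" "\<beta> < 1 / 2"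
    and gap: "\<exists>\<^sub>F d in at_right 0. d \<in> D \<and> D \<inter> {2 * d<..d powr (1 - 2 * \<beta>)} = {}"
    and pos: "0 < d"
  shows "\<exists>d'>0. d' \<in> D \<and> D \<inter> {2 * d'<..d' powr (1 - 2 * \<beta>)} = {} \<and>
    (\<exists>n\<ge>2. d' powr (\<beta> - 1 / 2) \<le> real n \<and> 2 * real n * d' \<le> d \<and>
      2 * real n * d' powr (1 - \<beta>) \<le> d powr (1 - \<beta>) \<and>
      real p * real n * d' powr (1 / 2 - 3 * \<beta> / 4) \<le> d)"
proof -
  have "\<forall>\<^sub>F x in at_right (0::real). 0 < x \<and> x < 1 \<and>
      4 * x powr (1 / 2 + \<beta>) < d \<and> 4 * x powr (1 / 2) < d powr (1 - \<beta>) \<and>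
      (2 * real p) * x powr (\<beta> / 4) < d"
    using pos \<beta>
    by (intro eventually_conj eventually_mult_powr_less eventually_at_right_less
        eventually_at_rightI[of 0 1]) auto
  from frequently_eventually_conj[OF gap this, THEN frequently_ex]
  obtain x where x: "0 < x" "x < 1" "x \<in> D" "D \<inter> {2 * x<..x powr (1 - 2 * \<beta>)} = {}"
    and small: "4 * x powr (1 / 2 + \<beta>) < d" "4 * x powr (1 / 2) < d powr (1 - \<beta>)"
      "(2 * real p) * x powr (\<beta> / 4) < d"
    by blast
  define n where "n = nat \<lceil>x powr (- (1 / 2 - \<beta>))\<rceil>"
  have n: "2 \<le> n" "x powr (- (1 / 2 - \<beta>)) \<le> real n" "real n \<le> 2 * x powr (- (1 / 2 - \<beta>))"
    unfolding n_def using ceiling_powr_bounds[of x "1 / 2 - \<beta>"] x \<beta> by auto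
  have upper: "real n * x powr a \<le> 2 * x powr (a - (1 / 2 - \<beta>))" for a
  proof -
    have "real n * x powr a \<le> 2 * x powr (- (1 / 2 - \<beta>)) * x powr a"
      using n(3) by (intro mult_right_mono) auto
    also have "\<dots> = 2 * x powr (a - (1 / 2 - \<beta>))"
      by (simp add: powr_add[symmetric] algebra_simps)
    finally show ?thesis .
  qed
  have "2 * real n * x \<le> d"
    using upper[of 1] small(1) x by simp
  moreover have "2 * real n * x powr (1 - \<beta>) \<le> d powr (1 - \<beta>)"
    using upper[of "1 - \<beta>"] small(2) by simp
  moreover have "real p * real n * x powr (1 / 2 - 3 * \<beta> / 4) \<le> d"
  proof -
    have "real p * (real n * x powr (1 / 2 - 3 * \<beta> / 4))
        \<le> real p * (2 * x powr ((1 / 2 - 3 * \<beta> / 4) - (1 / 2 - \<beta>)))"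
      by (intro mult_left_mono upper) auto
    also have "(1 / 2 - 3 * \<beta> / 4) - (1 / 2 - \<beta>) = \<beta> / 4"
      by simp
    finally show ?thesis
      using small(3) by (simp add: mult_ac)
  qed
  moreover have "x powr (\<beta> - 1 / 2) \<le> real n"
    using n(2) by simp
  ultimately show ?thesis
    using x n(1) by blast
qed

lemma scale_sequence:
  assumes \<beta>: "0 < \<beta>" "\<beta> < 1 / 2"
    and gap: "\<exists>\<^sub>F d in at_right 0. d \<in> D \<and> D \<inter> {2 * d<..d powr (1 - 2 * \<beta>)} = {}"
  obtains d :: "nat \<Rightarrow> real" and N :: "nat \<Rightarrow> nat" where
    "d 0 = 1" "\<And>k. 0 < d k" "\<And>k. d (Suc k) \<in> D"
    "\<And>k. D \<inter> {2 * d (Suc k)<..d (Suc k) powr (1 - 2 * \<beta>)} = {}"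
    "\<And>k. 2 \<le> N k" "\<And>k. d (Suc k) powr (\<beta> - 1 / 2) \<le> real (N k)"
    "\<And>k. 2 * real (N k) * d (Suc k) \<le> d k"
    "\<And>k. 2 * real (N k) * d (Suc k) powr (1 - \<beta>) \<le> d k powr (1 - \<beta>)"
    "\<And>k. real (\<Prod>i<Suc k. N i) * d (Suc k) powr (1 / 2 - 3 * \<beta> / 4) \<le> d k"
proof -
  define step where "step d p d' n \<longleftrightarrow> d' \<in> D \<and>
    D \<inter> {2 * d'<..d' powr (1 - 2 * \<beta>)} = {} \<and> 2 \<le> n \<and> d' powr (\<beta> - 1 / 2) \<le> real n \<and>
    2 * real n * d' \<le> d \<and> 2 * real n * d' powr (1 - \<beta>) \<le> d powr (1 - \<beta>) \<and>
    real p * real n * d' powr (1 / 2 - 3 * \<beta> / 4) \<le> d" for d d' :: real and p n :: nat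
  have "\<exists>f :: nat \<Rightarrow> real \<times> nat. \<forall>k. (0 < fst (f k) \<and> (k = 0 \<longrightarrow> f k = (1, 1))) \<and>
      (\<exists>n. step (fst (f k)) (snd (f k)) (fst (f (Suc k))) n \<and> snd (f (Suc k)) = snd (f k) * n)"
  proof (rule dependent_nat_choice)
    show "\<exists>x::real \<times> nat. 0 < fst x \<and> ((0::nat) = 0 \<longrightarrow> x = (1, 1))"
      by (intro exI[of _ "(1, 1)"]) simp
  next
    fix x :: "real \<times> nat" and k :: nat
    assume "0 < fst x \<and> (k = 0 \<longrightarrow> x = (1, 1))"
    then obtain d' n where "0 < d'" "step (fst x) (snd x) d' n"
      using next_scale[OF \<beta> gap, of "fst x" "snd x"] unfolding step_def by blast
    then show "\<exists>y. (0 < fst y \<and> (Suc k = 0 \<longrightarrow> y = (1, 1))) \<and>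
        (\<exists>n. step (fst x) (snd x) (fst y) n \<and> snd y = snd x * n)"
      by (intro exI[of _ "(d', snd x * n)"]) auto
  qed
  then obtain f :: "nat \<Rightarrow> real \<times> nat" where f: "\<And>k. 0 < fst (f k)" "f 0 = (1, 1)"
    "\<forall>k. \<exists>n. step (fst (f k)) (snd (f k)) (fst (f (Suc k))) n \<and> snd (f (Suc k)) = snd (f k) * n"
    by blast
  then obtain N where N: "\<And>k. step (fst (f k)) (snd (f k)) (fst (f (Suc k))) (N k)"
    "\<And>k. snd (f (Suc k)) = snd (f k) * N k"
    by metis
  have prod: "snd (f k) = (\<Prod>i<k. N i)" for k
    by (induction k) (simp_all add: f(2) N(2))
  show thesis
    using N(1) f(1,2) by (intro that[of "\<lambda>k. fst (f k)" N]) (auto simp: step_def prod)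
qed

text \<open>For the image the admissible diameters fall into two regimes. Let \<open>j\<close> be
the last index with \<open>r \<le> 2 * d j\<close>. Since \<open>D\<close> has a gap above
\<open>2 * d (Suc j)\<close>, even \<open>d (Suc j) powr (1 - 2 * \<beta>) < r\<close>. Pairs of
image points within distance \<open>r\<close> that separate after level \<open>j\<close> come from
one cell of level \<open>Suc j\<close>, of length at most
\<open>d (Suc j) powr (1 / 2 - \<beta>) < r powr (1 / 2)\<close>. Pairs that separate earlier come
from points at distance at most a constant times \<open>r\<close> divided by the total length of
the intervals of level \<open>j\<close>, which is at least
\<open>d j powr (1 - \<beta>) * d j powr (\<beta> - 1 / 2) = d j powr (1 / 2)\<close>; since
\<open>r \<le> 2 * d j\<close>, this is again of order \<open>r powr (1 / 2)\<close>.\<close>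

lemma gap_separates_dimensions:
  assumes D: "D \<in> scale_sets" and \<beta>: "0 < \<beta>" "\<beta> < 1 / 2"
    and gap: "\<exists>\<^sub>F d in at_right 0. d \<in> D \<and> D \<inter> {2 * d<..d powr (1 - 2 * \<beta>)} = {}"
  shows "\<exists>f K. hoelder (1 - \<beta>) f \<and> compact K \<and> K \<subseteq> {0..1} \<and>
    dimH_D D K \<le> ereal (1 / 2 - 3 * \<beta> / 4) \<and> ereal (1 / 2) \<le> dimH_D D (f ` K)"
proof -
  obtain d :: "nat \<Rightarrow> real" and N :: "nat \<Rightarrow> nat" where d0: "d 0 = 1" and dpos: "\<And>k. 0 < d k"
    and dD: "\<And>k. d (Suc k) \<in> D"
    and dgap: "\<And>k. D \<inter> {2 * d (Suc k)<..d (Suc k) powr (1 - 2 * \<beta>)} = {}"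
    and N2: "\<And>k. 2 \<le> N k" and N_ge: "\<And>k. d (Suc k) powr (\<beta> - 1 / 2) \<le> real (N k)"
    and N_d: "\<And>k. 2 * real (N k) * d (Suc k) \<le> d k"
    and N_e: "\<And>k. 2 * real (N k) * d (Suc k) powr (1 - \<beta>) \<le> d k powr (1 - \<beta>)"
    and N_prod: "\<And>k. real (\<Prod>i<Suc k. N i) * d (Suc k) powr (1 / 2 - 3 * \<beta> / 4) \<le> d k"
    by (rule scale_sequence[OF \<beta> gap]) (rule that)
  interpret branching N
    by unfold_locales (rule N2)
  interpret d: cantor_embedding N d
    by unfold_locales (use dpos N_d in auto)
  interpret e: cantor_embedding N "\<lambda>k. d k powr (1 - \<beta>)"
    by unfold_locales (use dpos N_e in \<open>auto simp: less_imp_neq[symmetric]\<close>)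
  define I where "I = {0..<1::real}"
  \<comment> \<open>The closure makes the set compact without any discussion of the missing end points; finite
    covers by closed sets and lower bounds for subsets both carry over to it.\<close>
  define K where "K = closure (d.embed ` I)"
  have sub01: "d.embed ` A \<subseteq> {0..1}" for A
    using d.embed_in_range d0 by auto
  have K01: "K \<subseteq> {0..1}"
    unfolding K_def by (intro closure_minimal sub01) auto
  have "bounded K"
    using K01 by (rule bounded_subset[rotated]) auto
  then have "compact K"
    by (simp add: K_def compact_eq_bounded_closed)
  have dle: "d k \<le> (1 / 2) ^ k" for k
  proof (induction k)
    case (Suc k)
    have "2 * 1 * d (Suc k) \<le> 2 * real (N k) * d (Suc k)"
      using N2[of k] dpos[of "Suc k"] by (intro mult_right_mono mult_left_mono) auto
    with N_d[of k] Suc show ?case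
      by simp
  qed (simp add: d0)
  have small: "\<exists>k. d k < \<eta>" if \<eta>: "0 < \<eta>" for \<eta>
  proof -
    obtain k where "(1 / 2) ^ k < \<eta>"
      using real_arch_pow_inv[OF \<eta>, of "1 / 2"] by auto
    with dle[of k] show ?thesis
      by (intro exI[of _ k]) simp
  qed

  have "\<exists>f. hoelder (1 - \<beta>) f \<and> (\<forall>x\<in>I. f (d.embed x) = e.embed x)"
    using \<beta> embed_hoelder[OF _ _ d.cantor_embedding_axioms e.cantor_embedding_axioms]
    by (intro hoelder_extension[where C = 4]) (auto simp: I_def)
  then obtain f where hf: "hoelder (1 - \<beta>) f" and f: "\<And>x. x \<in> I \<Longrightarrow> f (d.embed x) = e.embed x"
    by blast

  define s where "s = 1 / 2 - 3 * \<beta> / 4"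
  have s: "0 < s"
    using \<beta> by (simp add: s_def)
  have "content_D D s K = 0"
  proof (rule content_D_eq_0I[OF D])
    fix \<eta> :: real assume \<eta>: "0 < \<eta>"
    obtain k where k: "d k < \<eta> / 2"
      using small[of "\<eta> / 2"] \<eta> by auto
    obtain \<sigma> where \<sigma>: "\<forall>i::nat. \<sigma> i \<in> D \<and> 0 < \<sigma> i \<and> \<sigma> i < 1"
      and \<sigma>_sum: "(\<Sum>i. ennreal (\<sigma> i powr s)) \<le> ennreal (\<eta> / 2)"
      using small_scale_sequence[OF D s zero_less_one half_gt_zero[OF \<eta>]] by blast
    define n where "n = num_cells (Suc k)"
    define S where "S i = d.embed ` {x\<in>I. cell (Suc k) x = int i}" for i
    \<comment> \<open>The infinitely many remaining sets of the cover are empty, but each of them still has to be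
      charged for some scale.\<close>
    define \<rho> where "\<rho> i = (if i < n then d (Suc k) else \<sigma> i)" for i
    have S_bounded: "bounded (S i)" for i
      unfolding S_def using sub01 by (rule bounded_subset[rotated]) auto
    have "d.embed ` I \<subseteq> (\<Union>i<n. closure (S i))"
    proof
      fix z assume "z \<in> d.embed ` I"
      then obtain x where x: "x \<in> I" "z = d.embed x"
        by blast
      then have "cell (Suc k) x \<in> {0..<int n}"
        unfolding n_def I_def by (intro cell_in_range)
      then have "nat (cell (Suc k) x) < n" "z \<in> S (nat (cell (Suc k) x))"
        using x by (auto simp: S_def)
      then show "z \<in> (\<Union>i<n. closure (S i))"
        using closure_subset by blast
    qed
    then have "K \<subseteq> (\<Union>i<n. closure (S i))"
      unfolding K_def by (intro closure_minimal) auto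
    then have cover: "K \<subseteq> (\<Union>i. closure (S i))"
      by blast
    have diam: "diameter (closure (S i)) \<le> \<rho> i" for i
    proof (cases "i < n")
      case True
      have "diameter (S i) \<le> d (Suc k)"
        using d.embed_diff_le_of_cell_eq dpos[of "Suc k"]
        by (intro diameter_le) (auto simp: S_def)
      with True show ?thesis
        by (simp add: \<rho>_def diameter_closure[OF S_bounded])
    next
      case False
      have "S i = {}"
        using cell_in_range[of _ "Suc k"] False by (fastforce simp: S_def I_def n_def)
      with False \<sigma> show ?thesis
        by (auto simp: \<rho>_def less_imp_le)
    qed
    have "(\<Sum>i. ennreal (if i < n then d (Suc k) powr s else 0))
        = (\<Sum>i<n. ennreal (if i < n then d (Suc k) powr s else 0))"
      by (intro suminf_finite) auto
    also have "\<dots> = ennreal (real n * d (Suc k) powr s)"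
      by (simp add: ennreal_mult ennreal_of_nat_eq_real_of_nat)
    also have "\<dots> \<le> ennreal (\<eta> / 2)"
      using N_prod[of k] k by (intro ennreal_leI) (simp add: n_def num_cells_def s_def)
    finally have head_sum: "(\<Sum>i. ennreal (if i < n then d (Suc k) powr s else 0)) \<le> ennreal (\<eta> / 2)" .
    have "(\<Sum>i. ennreal (\<rho> i powr s))
        \<le> (\<Sum>i. ennreal (if i < n then d (Suc k) powr s else 0) + ennreal (\<sigma> i powr s))"
      by (intro suminf_le summableI) (auto simp: \<rho>_def)
    also have "\<dots> = (\<Sum>i. ennreal (if i < n then d (Suc k) powr s else 0)) + (\<Sum>i. ennreal (\<sigma> i powr s))"
      by (intro suminf_add[symmetric] summableI)
    also have "\<dots> \<le> ennreal (\<eta> / 2) + ennreal (\<eta> / 2)"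
      by (intro add_mono head_sum \<sigma>_sum)
    also have "\<dots> = ennreal \<eta>"
      using \<eta> by (simp flip: ennreal_plus)
    finally have sum: "(\<Sum>i. ennreal (\<rho> i powr s)) \<le> ennreal \<eta>" .
    have "\<rho> i \<in> D" for i
      using dD \<sigma> by (simp add: \<rho>_def)
    with cover diam sum S_bounded show "\<exists>U \<rho>. K \<subseteq> (\<Union>i::nat. U i) \<and>
        (\<forall>i. bounded (U i) \<and> diameter (U i) \<le> \<rho> i \<and> \<rho> i \<in> D) \<and>
        (\<Sum>i. ennreal (\<rho> i powr s)) \<le> ennreal \<eta>"
      by (intro exI[of _ "\<lambda>i. closure (S i)"] exI[of _ \<rho>]) auto
  qed
  then have dimK: "dimH_D D K \<le> ereal s"
    using s by (intro dimH_D_leI) auto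

  have num_cells_ge: "d k powr (\<beta> - 1 / 2) \<le> real (num_cells k)" for k
  proof (cases k)
    case (Suc j)
    have "1 * real (N j) \<le> real (num_cells j) * real (N j)"
      using num_cells_pos[of j] by (intro mult_right_mono) auto
    with N_ge[of j] show ?thesis
      by (simp add: Suc num_cells_Suc)
  qed (simp add: d0)
  have main: "y - x \<le> 8 * r powr (1 / 2)"
    if xy: "x \<in> {0..<1}" "y \<in> {0..<1}" "x < y" and r: "r \<in> D" "r < 1"
      and dist: "dist (e.embed x) (e.embed y) \<le> r" for x y r
  proof -
    have r0: "0 < r"
      using r D by (auto simp: scale_sets_def)
    obtain n m where eq: "cell n x = cell n y" and m: "cell (Suc n) y = cell (Suc n) x + m" "1 \<le> m"
      by (rule separation_level[OF xy]) (rule that)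
    define k where "k = (LEAST k. 2 * d k < r)"
    have "\<exists>k. 2 * d k < r"
      using small[of "r / 2"] r0 by (simp add: field_simps)
    then have k: "2 * d k < r"
      unfolding k_def by (rule LeastI_ex)
    then obtain j where j: "k = Suc j"
      using d0 r by (cases k) auto
    have rj: "r \<le> 2 * d j"
      using not_less_Least[of j "\<lambda>k. 2 * d k < r"] j by (simp add: k_def)
    have gapj: "d (Suc j) powr (1 - 2 * \<beta>) < r"
      using dgap[of j] r k j by (auto simp: not_le[symmetric])
    show ?thesis
    proof (cases "n \<le> j")
      case False
      have "y - x \<le> 1 / num_cells n"
        by (rule diff_le_of_cell_eq[OF eq])
      also have "\<dots> \<le> 1 / num_cells (Suc j)"
        using mono_num_cells[of "Suc j" n] False num_cells_pos[of "Suc j"] by (intro divide_left_mono) auto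
      also have "\<dots> \<le> 1 / d (Suc j) powr (\<beta> - 1 / 2)"
        using num_cells_ge[of "Suc j"] dpos[of "Suc j"] num_cells_pos[of "Suc j"]
        by (intro divide_left_mono) (auto simp: less_imp_neq[symmetric])
      also have "\<dots> = d (Suc j) powr (1 / 2 - \<beta>)"
        by (simp add: powr_minus_divide[symmetric])
      also have "\<dots> = (d (Suc j) powr (1 - 2 * \<beta>)) powr (1 / 2)"
        by (simp add: powr_powr algebra_simps)
      also have "\<dots> \<le> r powr (1 / 2)"
        using gapj by (intro powr_mono2) auto
      also have "\<dots> \<le> 8 * r powr (1 / 2)"
        by simp
      finally show ?thesis .
    next
      case True
      have half: "d j powr (1 / 2) = d j powr (1 - \<beta>) * d j powr (\<beta> - 1 / 2)"
        by (simp add: powr_add[symmetric])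
      have "(y - x) * d j powr (1 / 2) \<le> (y - x) * (d j powr (1 - \<beta>) * num_cells j)"
        unfolding half using xy(3) num_cells_ge[of j] by (intro mult_left_mono) auto
      also have "\<dots> \<le> 4 * (e.embed y - e.embed x)"
        by (rule e.diff_le_embed_diff[OF eq m True])
      also have "\<dots> \<le> 4 * r"
        using dist by (simp add: dist_real_def)
      also have "\<dots> = 4 * (r powr (1 / 2) * r powr (1 / 2))"
        using r0 by (simp add: powr_add[symmetric])
      also have "\<dots> \<le> 4 * (r powr (1 / 2) * (2 * d j powr (1 / 2)))"
      proof -
        have "r powr (1 / 2) \<le> (4 * d j) powr (1 / 2)"
          using rj r0 dpos[of j] by (intro powr_mono2) auto
        also have "\<dots> = 2 * d j powr (1 / 2)"
          by (simp add: powr_mult powr_half_sqrt)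
        finally show ?thesis
          by (intro mult_left_mono) auto
      qed
      also have "\<dots> = (8 * r powr (1 / 2)) * d j powr (1 / 2)"
        by simp
      finally show ?thesis
        by (rule mult_right_le_imp_le) (use dpos[of j] in auto)
    qed
  qed
  have "ereal (1 / 2) \<le> dimH_D D (f ` K)"
  proof (rule dimH_D_image_ge[OF D])
    fix x y r :: real
    assume *: "x \<in> {0..<1}" "y \<in> {0..<1}" "r \<in> D" "r < 1" "dist (e.embed x) (e.embed y) \<le> r"
    show "\<bar>x - y\<bar> \<le> 8 * r powr (1 / 2)"
      using main[of x y r] main[of y x r] *
      by (cases x y rule: linorder_cases) (auto simp: dist_commute)
  next
    have "d.embed ` I \<subseteq> K"
      unfolding K_def by (rule closure_subset)
    then show "e.embed ` {0..<1} \<subseteq> f ` K"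
      using f by (force simp: I_def)
  qed simp
  then show ?thesis
    using hf \<open>compact K\<close> K01 dimK unfolding s_def by blast
qed

theorem theorem3p12:
  fixes D :: "real set"
  assumes "D \<in> scale_sets"
    and "\<And>(\<alpha>::real) (f::real \<Rightarrow> real) (K::real set).
           0 < \<alpha> \<Longrightarrow> \<alpha> \<le> 1 \<Longrightarrow> hoelder \<alpha> f \<Longrightarrow> compact K \<Longrightarrow> K \<subseteq> {0..1} \<Longrightarrow>
           dimH_D D (f ` K) \<le> ereal (1 / \<alpha>) * dimH_D D K"
  shows "\<forall>E :: (real ^ 'n) set. dimH_D D E = hausdorff_dim E"
proof -
  have dense: "\<forall>\<^sub>F r in at_right 0. D \<inter> {r..r powr (1 - \<epsilon>)} \<noteq> {}" if \<epsilon>: "0 < \<epsilon>" "\<epsilon> < 1" for \<epsilon>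
  proof (rule ccontr)
    assume "\<not> (\<forall>\<^sub>F r in at_right 0. D \<inter> {r..r powr (1 - \<epsilon>)} \<noteq> {})"
    then have "\<exists>\<^sub>F r in at_right 0. D \<inter> {r..r powr (1 - \<epsilon>)} = {}"
      by (simp add: frequently_def)
    from frequently_scale_below_gap[OF assms(1) \<epsilon> this]
    have gap: "\<exists>\<^sub>F d in at_right 0. d \<in> D \<and> D \<inter> {2 * d<..d powr (1 - 2 * (\<epsilon> / 2))} = {}"
      by simp
    have \<beta>: "0 < \<epsilon> / 2" "\<epsilon> / 2 < 1 / 2"
      using \<epsilon> by auto
    obtain f K where hoel: "hoelder (1 - \<epsilon> / 2) f" and K: "compact K" "K \<subseteq> {0..1}"
      and dims: "dimH_D D K \<le> ereal (1 / 2 - 3 * (\<epsilon> / 2) / 4)" "ereal (1 / 2) \<le> dimH_D D (f ` K)"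
      using gap_separates_dimensions[OF assms(1) \<beta> gap] by blast
    have "ereal (1 / 2) \<le> ereal (1 / (1 - \<epsilon> / 2)) * dimH_D D K"
      using dims(2) assms(2)[OF _ _ hoel K] \<epsilon> by (auto intro: order_trans)
    also have "\<dots> \<le> ereal (1 / (1 - \<epsilon> / 2)) * ereal (1 / 2 - 3 * (\<epsilon> / 2) / 4)"
      using dims(1) \<epsilon> by (intro ereal_mult_left_mono) auto
    finally have "1 / 2 \<le> (1 / (1 - \<epsilon> / 2)) * (1 / 2 - 3 * (\<epsilon> / 2) / 4)"
      by simp
    with \<epsilon> show False
      by (simp add: field_simps)
  qed
  show ?thesis
    using dimH_D_le_hausdorff_dim[OF assms(1) dense] hausdorff_dim_le_dimH_D[OF assms(1)]
    by (intro allI antisym)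
qed

end
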